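(* There is a one-to-one correspondence between skeletal $2$-term $L_\infty$-triple algebras (skeletal Lie triple $2$-algebras) and tuples consisting of a Lie triple algebra $T$, a vector space $V$, a representation $(\rho,\theta,D)$ of $T$ on $V$, and a $(3,4,4,5)$-cocycle $(l_3,\widehat l_4,\widetilde l_4,l_5)$ of the Lie triple algebra $T$ with coefficients in the representation $V$.
   Context: $k$ is an algebraically closed field of characteristic different from $2$ and $3$; everything is $k$-linear. "c.p." denotes the terms obtained by cyclically permuting the arguments with indices $1,2,3$ ($x_1,x_2,x_3$, or $x_1,x_2,u_3$). The correspondence is: $T=V_0$, $V=V_1$, $\rho(x_1)(u)=[x_1,u]$, $D(x_1,x_2)(u)=[x_1,x_2,u]$, $\theta(x_1,x_2)(u)=[u,x_1,x_2]$, with the same $l_3,\widehat l_4,\widetilde l_4,l_5$. Write $X=(x_1,x_2)$, $Y=(y_1,y_2)$, $[X,z]=[x_1,x_2,z]$, $[Y,z]=[y_1,y_2,z]$, and $f(X\circ Y,\dots)=f([X,y_1],y_2,\dots)+f(y_1,[X,y_2],\dots)$. **Lie triple algebra.** A vector space $T$ with a bilinear map $[\cdot,\cdot]$ and a trilinear map $[\cdot,\cdot,\cdot]$ into $T$ such that: (LY1) $[x_1,x_2]+[x_2,x_1]=0$; (LY2) $[x_1,x_2,x_3]+[x_2,x_1,x_3]=0$; (LY3) $[[x_1,x_2],x_3]+c.p.+[x_1,x_2,x_3]+c.p.=0$; (LY4) $[[x_1,x_2],x_3,y_1]+c.p.=0$; (LY5) $[x_1,x_2,[y_1,y_2]]=[[x_1,x_2,y_1],y_2]+[y_1,[x_1,x_2,y_2]]$;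 (LY6) $[x_1,x_2,[y_1,y_2,y_3]]=[[x_1,x_2,y_1],y_2,y_3]+[y_1,[x_1,x_2,y_2],y_3]+[y_1,y_2,[x_1,x_2,y_3]]$. **Representation** of $T$ on $V$: a linear map $\rho:T\to\mathrm{End}(V)$ and bilinear maps $D,\theta:T\times T\to\mathrm{End}(V)$ with (commutators in $\mathrm{End}(V)$): (R31) $D(x_1,x_2)-\theta(x_2,x_1)+\theta(x_1,x_2)+\rho([x_1,x_2])-[\rho(x_1),\rho(x_2)]=0$; (R41) $D([x_1,x_2],x_3)+D([x_2,x_3],x_1)+D([x_3,x_1],x_2)=0$; (R42) $\theta([x_1,x_2],x_3)=\theta(x_1,x_3)\rho(x_2)-\theta(x_2,x_3)\rho(x_1)$; (R51) $[D(x_1,x_2),\rho(y_2)]=\rho([x_1,x_2,y_2])$; (R52) $\theta(x_1,[y_1,y_2])=\rho(y_1)\theta(x_1,y_2)-\rho(y_2)\theta(x_1,y_1)$; (R61) $[D(x_1,x_2),\theta(y_1,y_2)]=\theta([x_1,x_2,y_1],y_2)+\theta(y_1,[x_1,x_2,y_2])$; (R62) $\theta(x_1,[y_1,y_2,y_3])=\theta(y_2,y_3)\theta(x_1,y_1)-\theta(y_1,y_3)\theta(x_1,y_2)+D(y_1,y_2)\theta(x_1,y_3)$. **2-term $L_\infty$-triple algebra** (also called a Lie triple 2-algebra) $(V_1,V_0,\mathrm d,l_3,\widehat l_4,\widetilde l_4,l_5)$: a complex of vector spaces $V_1\xrightarrow{\mathrm d}V_0$; bilinear maps $[\cdot,\cdot]:V_i\times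 V_j\to V_{i+j}$ ($0\le i+j\le1$); trilinear maps $[\cdot,\cdot,\cdot]:V_i\times V_j\times V_k\to V_{i+j+k}$ ($0\le i+j+k\le1$); multilinear maps $l_3:V_0^3\to V_1$, $\widehat l_4,\widetilde l_4:V_0^4\to V_1$, $l_5:V_0^5\to V_1$; such that for $x,x_i,y_i,z_i\in V_0$, $u,v,u_i\in V_1$: (a) $[x_1,x_2]=-[x_2,x_1]$, $[x,u]=-[u,x]$, $[x_1,x_2,x_3]=-[x_2,x_1,x_3]$, $[x_1,x_2,u]=-[x_2,x_1,u]$, $[u,x_1,x_2]=-[x_1,u,x_2]$; (b) $\mathrm d[x,u]=[x,\mathrm du]$, $[\mathrm du,v]=[u,\mathrm dv]$; (c) $\mathrm d[x_1,x_2,u]=[x_1,x_2,\mathrm du]$, $\mathrm d[u,x_1,x_2]=[\mathrm du,x_1,x_2]$; (d) $[\mathrm du,v,x]=[u,\mathrm dv,x]$, $[x,\mathrm du,v]=[x,u,\mathrm dv]$; (e$_1$) $\mathrm dl_3(x_1,x_2,x_3)=[[x_1,x_2],x_3]+c.p.+[x_1,x_2,x_3]+c.p.$, and $l_3(x_1,x_2,\mathrm du_3)=[[x_1,x_2],u_3]+c.p.+[x_1,x_2,u_3]+c.p.$; (e$_2$) $\mathrm d\widehat l_4(x_1,x_2,x_3,y_1)=[[x_1,x_2],x_3,y_1]+c.p.$, and $\widehat l_4(x_1,x_2,x_3,\mathrm du_1)=[[x_1,x_2],x_3,u_1]+c.p.$; (e$_3$) $\mathrm d\widetilde l_4(x_1,x_2,y_1,y_2)=[[x_1,x_2,y_1],y_2]+[y_1,[x_1,x_2,y_2]]-[x_1,x_2,[y_1,y_2]]$,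 $\widetilde l_4(x_1,x_2,y_1,\mathrm du_2)=[[x_1,x_2,y_1],u_2]+[y_1,[x_1,x_2,u_2]]-[x_1,x_2,[y_1,u_2]]$, and $\widetilde l_4(x_1,\mathrm du_2,y_1,y_2)=[[x_1,u_2,y_1],y_2]+[y_1,[x_1,u_2,y_2]]-[x_1,u_2,[y_1,y_2]]$; (e$_4$) $\mathrm dl_5(x_1,x_2,y_1,y_2,y_3)=[[x_1,x_2,y_1],y_2,y_3]+[y_1,[x_1,x_2,y_2],y_3]+[y_1,y_2,[x_1,x_2,y_3]]-[x_1,x_2,[y_1,y_2,y_3]]$, $l_5(x_1,x_2,y_1,y_2,\mathrm du_3)=[[x_1,x_2,y_1],y_2,u_3]+[y_1,[x_1,x_2,y_2],u_3]+[y_1,y_2,[x_1,x_2,u_3]]-[x_1,x_2,[y_1,y_2,u_3]]$, and $l_5(x_1,\mathrm du_2,y_1,y_2,y_3)=[[x_1,u_2,y_1],y_2,y_3]+[y_1,[x_1,u_2,y_2],y_3]+[y_1,y_2,[x_1,u_2,y_3]]-[x_1,u_2,[y_1,y_2,y_3]]$; (f$_1$) $[X,l_3(y_1,y_2,y_3)]+\widetilde l_4(X,[y_1,y_2],y_3)+\widetilde l_4(X,y_2,[y_1,y_3])+[\widetilde l_4(X,y_1,y_2),y_3]+[y_2,\widetilde l_4(X,y_1,y_3)]+l_5(X,y_1,y_2,y_3)+l_5(X,y_3,y_1,y_2)=\widetilde l_4(X,y_1,[y_2,y_3])+[y_1,\widetilde l_4(X,y_2,y_3)]+l_3([X,y_1],y_2,y_3)+l_3(y_1,[X,y_2],y_3)+l_3(y_1,y_2,[X,y_3])+l_5(X,y_3,y_2,y_1)$;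 (f$_2$) $[X,\widehat l_4(y_1,y_2,y_3,z_1)]+l_5(X,[y_1,y_2],y_3,z_1)+l_5(X,y_2,[y_1,y_3],z_1)+[\widetilde l_4(X,y_1,y_2),y_3,z_1]+[y_2,\widetilde l_4(X,y_1,y_3),z_1]=l_5(X,y_1,[y_2,y_3],z_1)+\widehat l_4([X,y_1],y_2,y_3,z_1)+[y_1,\widetilde l_4(X,y_2,y_3),z_1]+\widehat l_4(y_1,y_2,y_3,[X,z_1])+\widehat l_4(y_1,[X,y_2],y_3,z_1)+\widehat l_4(y_1,y_2,[X,y_3],z_1)$; (f$_3$) $[X,\widetilde l_4(Y,z_1,z_2)]+\widetilde l_4(X,[Y,z_1],z_2)+\widetilde l_4(X,z_1,[Y,z_2])+[l_5(X,Y,z_1),z_2]+[z_1,l_5(X,Y,z_2)]=l_5(X,Y,[z_1,z_2])+[Y,\widetilde l_4(X,z_1,z_2)]+\widetilde l_4(X\circ Y,z_1,z_2)+\widetilde l_4(Y,[X,z_1],z_2)+\widetilde l_4(Y,z_1,[X,z_2])$; (f$_4$) $[l_5(X,Y,z_1),z_2,z_3]+[z_1,l_5(X,Y,z_2),z_3]+[X,l_5(Y,z_1,z_2,z_3)]+[z_1,z_2,l_5(X,Y,z_3)]+l_5(X,[Y,z_1],z_2,z_3)+l_5(X,z_1,[Y,z_2],z_3)+l_5(X,z_1,z_2,[Y,z_3])=[Y,l_5(X,z_1,z_2,z_3)]+l_5(X\circ Y,z_1,z_2,z_3)+l_5(Y,[X,z_1],z_2,z_3)+l_5(Y,z_1,[X,z_2],z_3)+l_5(X,Y,[z_1,z_2,z_3])+l_5(Y,z_1,z_2,[X,z_3])$.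 It is **skeletal** if $\mathrm d=0$. **Cochains.** $C^n(T,V)$ is the space of $n$-linear maps $f:T^n\to V$ with $f(x_1,\dots,x_n)=0$ whenever $x_{2i-1}=x_{2i}$, for each $i=1,\dots,\lfloor n/2\rfloor$. **(3,4,4,5)-cocycle** of $T$ with coefficients in $V$: a quadruple $(l_3,\widehat l_4,\widetilde l_4,l_5)$ with $l_3\in C^3(T,V)$, $\widehat l_4,\widetilde l_4\in C^4(T,V)$, $l_5\in C^5(T,V)$ such that the following four expressions vanish identically: $$\begin{aligned}&D(x_1,x_2)l_3(y_1,y_2,y_3)-l_3([X,y_1],y_2,y_3)-l_3(y_1,[X,y_2],y_3)-l_3(y_1,y_2,[X,y_3])\\&+\widetilde l_4(X,[y_1,y_2],y_3)+\widetilde l_4(X,y_2,[y_1,y_3])-\widetilde l_4(X,y_1,[y_2,y_3])-\rho(y_1)\widetilde l_4(X,y_2,y_3)+\rho(y_2)\widetilde l_4(X,y_1,y_3)\\&-\rho(y_3)\widetilde l_4(X,y_1,y_2)-l_5(X,y_1,y_2,y_3)-l_5(X,y_2,y_3,y_1)-l_5(X,y_3,y_1,y_2);\end{aligned}$$ $$\begin{aligned}&D(x_1,x_2)\widehat l_4(y_1,y_2,y_3,z_1)-\widehat l_4([X,y_1],y_2,y_3,z_1)-\widehat l_4(y_1,[X,y_2],y_3,z_1)-\widehat l_4(y_1,y_2,[X,y_3],z_1)-\widehat l_4(y_1,y_2,y_3,[X,z_1])\\&+\theta(y_1,z_1)\widetilde l_4(X,y_2,y_3)+\theta(y_3,z_1)\widetilde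 l_4(X,y_1,y_2)-\theta(y_2,z_1)\widetilde l_4(X,y_1,y_3)\\&+l_5(X,[y_1,y_2],y_3,z_1)+l_5(X,y_2,[y_1,y_3],z_1)-l_5(X,y_1,[y_2,y_3],z_1);\end{aligned}$$ $$\begin{aligned}&D(x_1,x_2)\widetilde l_4(Y,z_1,z_2)-D(y_1,y_2)\widetilde l_4(X,z_1,z_2)+\rho(z_1)l_5(X,Y,z_2)-\rho(z_2)l_5(X,Y,z_1)-l_5(X,Y,[z_1,z_2])\\&-\widetilde l_4([X,y_1],y_2,z_1,z_2)-\widetilde l_4(y_1,[X,y_2],z_1,z_2)-\widetilde l_4(Y,[X,z_1],z_2)-\widetilde l_4(Y,z_1,[X,z_2])\\&+\widetilde l_4(X,[Y,z_1],z_2)+\widetilde l_4(X,z_1,[Y,z_2]);\end{aligned}$$ $$\begin{aligned}&\theta(z_2,z_3)l_5(X,Y,z_1)-\theta(z_1,z_3)l_5(X,Y,z_2)+D(x_1,x_2)l_5(Y,z_1,z_2,z_3)-D(y_1,y_2)l_5(X,z_1,z_2,z_3)+D(z_1,z_2)l_5(X,Y,z_3)\\&-l_5([X,y_1],y_2,z_1,z_2,z_3)-l_5(y_1,[X,y_2],z_1,z_2,z_3)-l_5(Y,[X,z_1],z_2,z_3)-l_5(Y,z_1,[X,z_2],z_3)-l_5(Y,z_1,z_2,[X,z_3])\\&+l_5(X,[Y,z_1],z_2,z_3)+l_5(X,z_1,[Y,z_2],z_3)+l_5(X,z_1,z_2,[Y,z_3])-l_5(X,Y,[z_1,z_2,z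_3]).\end{aligned}$$
   Formalization: In the 2-term algebra, l_3, both l_4 and l_5 are required to lie in C^n; (e2) and (e4) gain the identity with the V_1-argument in third place; in the first cocycle expression the three l_5-terms have sign + instead of −. As printed, the correspondence fails. *)

theory Defs
  imports "HOL-Computational_Algebra.Computational_Algebra"
begin

text \<open>
  Vector spaces are given as in the library locale \<open>vector_space\<close>: an abelian group
  (a type of class \<open>ab_group_add\<close>) with a scalar multiplication.
\<close>

definition bilin ::
  "('k::field \<Rightarrow> 'a::ab_group_add \<Rightarrow> 'a) \<Rightarrow> ('k \<Rightarrow> 'b::ab_group_add \<Rightarrow> 'b) \<Rightarrow> ('k \<Rightarrow> 'c::ab_group_add \<Rightarrow> 'c) \<Rightarrow>
   ('a \<Rightarrow> 'b \<Rightarrow> 'c) \<Rightarrow> bool" where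
  "bilin s1 s2 t f \<longleftrightarrow>
     (\<forall>y. Vector_Spaces.linear s1 t (\<lambda>x. f x y)) \<and> (\<forall>x. Vector_Spaces.linear s2 t (f x))"

definition trilin ::
  "('k::field \<Rightarrow> 'a::ab_group_add \<Rightarrow> 'a) \<Rightarrow> ('k \<Rightarrow> 'b::ab_group_add \<Rightarrow> 'b) \<Rightarrow> ('k \<Rightarrow> 'c::ab_group_add \<Rightarrow> 'c) \<Rightarrow>
   ('k \<Rightarrow> 'd::ab_group_add \<Rightarrow> 'd) \<Rightarrow> ('a \<Rightarrow> 'b \<Rightarrow> 'c \<Rightarrow> 'd) \<Rightarrow> bool" where
  "trilin s1 s2 s3 t f \<longleftrightarrow>
     (\<forall>y z. Vector_Spaces.linear s1 t (\<lambda>x. f x y z)) \<and> (\<forall>x. bilin s2 s3 t (f x))"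

definition quadrilin ::
  "('k::field \<Rightarrow> 'a::ab_group_add \<Rightarrow> 'a) \<Rightarrow> ('k \<Rightarrow> 'b::ab_group_add \<Rightarrow> 'b) \<Rightarrow>
   ('a \<Rightarrow> 'a \<Rightarrow> 'a \<Rightarrow> 'a \<Rightarrow> 'b) \<Rightarrow> bool" where
  "quadrilin s t f \<longleftrightarrow>
     (\<forall>y z w. Vector_Spaces.linear s t (\<lambda>x. f x y z w)) \<and> (\<forall>x. trilin s s s t (f x))"

definition quinquelin ::
  "('k::field \<Rightarrow> 'a::ab_group_add \<Rightarrow> 'a) \<Rightarrow> ('k \<Rightarrow> 'b::ab_group_add \<Rightarrow> 'b) \<Rightarrow>
   ('a \<Rightarrow> 'a \<Rightarrow> 'a \<Rightarrow> 'a \<Rightarrow> 'a \<Rightarrow> 'b) \<Rightarrow> bool" where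
  "quinquelin s t f \<longleftrightarrow>
     (\<forall>y z v w. Vector_Spaces.linear s t (\<lambda>x. f x y z v w)) \<and> (\<forall>x. quadrilin s t (f x))"

text \<open>
  The cochain spaces $C^n(T,V)$ for $n = 3, 4, 5$, in curried form: multilinear maps vanishing
  whenever $x_{2i-1} = x_{2i}$ for some $i \le \lfloor n/2 \rfloor$.
\<close>

definition C3 ::
  "('k::field \<Rightarrow> 'a::ab_group_add \<Rightarrow> 'a) \<Rightarrow> ('k \<Rightarrow> 'b::ab_group_add \<Rightarrow> 'b) \<Rightarrow>
   ('a \<Rightarrow> 'a \<Rightarrow> 'a \<Rightarrow> 'b) set" where
  "C3 s t = {f. trilin s s s t f \<and> (\<forall>x y. f x x y = 0)}"

definition C4 ::
  "('k::field \<Rightarrow> 'a::ab_group_add \<Rightarrow> 'a) \<Rightarrow> ('k \<Rightarrow> 'b::ab_group_add \<Rightarrow> 'b) \<Rightarrow>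
   ('a \<Rightarrow> 'a \<Rightarrow> 'a \<Rightarrow> 'a \<Rightarrow> 'b) set" where
  "C4 s t = {f. quadrilin s t f \<and> (\<forall>x y z. f x x y z = 0) \<and> (\<forall>x y z. f x y z z = 0)}"

definition C5 ::
  "('k::field \<Rightarrow> 'a::ab_group_add \<Rightarrow> 'a) \<Rightarrow> ('k \<Rightarrow> 'b::ab_group_add \<Rightarrow> 'b) \<Rightarrow>
   ('a \<Rightarrow> 'a \<Rightarrow> 'a \<Rightarrow> 'a \<Rightarrow> 'a \<Rightarrow> 'b) set" where
  "C5 s t = {f. quinquelin s t f \<and> (\<forall>x y z w. f x x y z w = 0) \<and> (\<forall>x y z w. f x y z z w = 0)}"

locale lie_triple_algebra =
  vector_space sT for sT :: "'k::field \<Rightarrow> 'a::ab_group_add \<Rightarrow> 'a" +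
  fixes br :: "'a \<Rightarrow> 'a \<Rightarrow> 'a"
    and tr :: "'a \<Rightarrow> 'a \<Rightarrow> 'a \<Rightarrow> 'a"
  assumes br_bilin: "bilin sT sT sT br"
    and tr_trilin: "trilin sT sT sT sT tr"
    and LY1: "br x1 x2 + br x2 x1 = 0"
    and LY2: "tr x1 x2 x3 + tr x2 x1 x3 = 0"
    and LY3: "br (br x1 x2) x3 + br (br x2 x3) x1 + br (br x3 x1) x2
              + tr x1 x2 x3 + tr x2 x3 x1 + tr x3 x1 x2 = 0"
    and LY4: "tr (br x1 x2) x3 y1 + tr (br x2 x3) x1 y1 + tr (br x3 x1) x2 y1 = 0"
    and LY5: "tr x1 x2 (br y1 y2) = br (tr x1 x2 y1) y2 + br y1 (tr x1 x2 y2)"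
    and LY6: "tr x1 x2 (tr y1 y2 y3) =
                tr (tr x1 x2 y1) y2 y3 + tr y1 (tr x1 x2 y2) y3 + tr y1 y2 (tr x1 x2 y3)"

text \<open>
  Linear maps into $\mathrm{End}(V)$ are curried: linearity of each operator and linear
  dependence on the elements of $T$ are together multilinearity.
\<close>

locale lie_triple_representation =
  lie_triple_algebra sT br tr + V: vector_space sV
  for sT :: "'k::field \<Rightarrow> 'a::ab_group_add \<Rightarrow> 'a" and br tr
    and sV :: "'k \<Rightarrow> 'b::ab_group_add \<Rightarrow> 'b" +
  fixes \<rho> :: "'a \<Rightarrow> 'b \<Rightarrow> 'b"
    and \<theta> :: "'a \<Rightarrow> 'a \<Rightarrow> 'b \<Rightarrow> 'b"
    and D :: "'a \<Rightarrow> 'a \<Rightarrow> 'b \<Rightarrow> 'b"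
  assumes rho_lin: "bilin sT sV sV \<rho>"
    and theta_lin: "trilin sT sT sV sV \<theta>"
    and D_lin: "trilin sT sT sV sV D"
    and R31: "D x1 x2 u - \<theta> x2 x1 u + \<theta> x1 x2 u + \<rho> (br x1 x2) u
                - (\<rho> x1 (\<rho> x2 u) - \<rho> x2 (\<rho> x1 u)) = 0"
    and R41: "D (br x1 x2) x3 u + D (br x2 x3) x1 u + D (br x3 x1) x2 u = 0"
    and R42: "\<theta> (br x1 x2) x3 u = \<theta> x1 x3 (\<rho> x2 u) - \<theta> x2 x3 (\<rho> x1 u)"
    and R51: "D x1 x2 (\<rho> y2 u) - \<rho> y2 (D x1 x2 u) = \<rho> (tr x1 x2 y2) u"
    and R52: "\<theta> x1 (br y1 y2) u = \<rho> y1 (\<theta> x1 y2 u) - \<rho> y2 (\<theta> x1 y1 u)"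
    and R61: "D x1 x2 (\<theta> y1 y2 u) - \<theta> y1 y2 (D x1 x2 u) =
                \<theta> (tr x1 x2 y1) y2 u + \<theta> y1 (tr x1 x2 y2) u"
    and R62: "\<theta> x1 (tr y1 y2 y3) u =
                \<theta> y2 y3 (\<theta> x1 y1 u) - \<theta> y1 y3 (\<theta> x1 y2 u) + D y1 y2 (\<theta> x1 y3 u)"

text \<open>
  In the first cocycle identity the three $l_5$-terms carry the sign $+$, where the source has
  $-$. The sign $+$ agrees with the coherence identity \<open>f1\<close> below, which in turn is forced by \<open>e1a\<close>,
  \<open>e3a\<close> and \<open>e4a\<close> whenever the differential is injective. With the sign $-$ the
  cocycle identity and \<open>f1\<close> are incompatible.
\<close>

locale cocycle_3445 =
  lie_triple_representation sT br tr sV \<rho> \<theta> D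
  for sT :: "'k::field \<Rightarrow> 'a::ab_group_add \<Rightarrow> 'a" and br tr
    and sV :: "'k \<Rightarrow> 'b::ab_group_add \<Rightarrow> 'b" and \<rho> \<theta> D +
  fixes l3 :: "'a \<Rightarrow> 'a \<Rightarrow> 'a \<Rightarrow> 'b"
    and l4h :: "'a \<Rightarrow> 'a \<Rightarrow> 'a \<Rightarrow> 'a \<Rightarrow> 'b"
    and l4t :: "'a \<Rightarrow> 'a \<Rightarrow> 'a \<Rightarrow> 'a \<Rightarrow> 'b"
    and l5 :: "'a \<Rightarrow> 'a \<Rightarrow> 'a \<Rightarrow> 'a \<Rightarrow> 'a \<Rightarrow> 'b"
  assumes l3_C3: "l3 \<in> C3 sT sV"
    and l4h_C4: "l4h \<in> C4 sT sV"
    and l4t_C4: "l4t \<in> C4 sT sV"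
    and l5_C5: "l5 \<in> C5 sT sV"
    and cocycle1:
      "D x1 x2 (l3 y1 y2 y3)
       - l3 (tr x1 x2 y1) y2 y3 - l3 y1 (tr x1 x2 y2) y3 - l3 y1 y2 (tr x1 x2 y3)
       + l4t x1 x2 (br y1 y2) y3 + l4t x1 x2 y2 (br y1 y3) - l4t x1 x2 y1 (br y2 y3)
       - \<rho> y1 (l4t x1 x2 y2 y3) + \<rho> y2 (l4t x1 x2 y1 y3) - \<rho> y3 (l4t x1 x2 y1 y2)
       + l5 x1 x2 y1 y2 y3 + l5 x1 x2 y2 y3 y1 + l5 x1 x2 y3 y1 y2 = 0"
    and cocycle2:
      "D x1 x2 (l4h y1 y2 y3 z1)
       - l4h (tr x1 x2 y1) y2 y3 z1 - l4h y1 (tr x1 x2 y2) y3 z1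
       - l4h y1 y2 (tr x1 x2 y3) z1 - l4h y1 y2 y3 (tr x1 x2 z1)
       + \<theta> y1 z1 (l4t x1 x2 y2 y3) + \<theta> y3 z1 (l4t x1 x2 y1 y2) - \<theta> y2 z1 (l4t x1 x2 y1 y3)
       + l5 x1 x2 (br y1 y2) y3 z1 + l5 x1 x2 y2 (br y1 y3) z1 - l5 x1 x2 y1 (br y2 y3) z1 = 0"
    and cocycle3:
      "D x1 x2 (l4t y1 y2 z1 z2) - D y1 y2 (l4t x1 x2 z1 z2)
       + \<rho> z1 (l5 x1 x2 y1 y2 z2) - \<rho> z2 (l5 x1 x2 y1 y2 z1) - l5 x1 x2 y1 y2 (br z1 z2)
       - l4t (tr x1 x2 y1) y2 z1 z2 - l4t y1 (tr x1 x2 y2) z1 z2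
       - l4t y1 y2 (tr x1 x2 z1) z2 - l4t y1 y2 z1 (tr x1 x2 z2)
       + l4t x1 x2 (tr y1 y2 z1) z2 + l4t x1 x2 z1 (tr y1 y2 z2) = 0"
    and cocycle4:
      "\<theta> z2 z3 (l5 x1 x2 y1 y2 z1) - \<theta> z1 z3 (l5 x1 x2 y1 y2 z2)
       + D x1 x2 (l5 y1 y2 z1 z2 z3) - D y1 y2 (l5 x1 x2 z1 z2 z3) + D z1 z2 (l5 x1 x2 y1 y2 z3)
       - l5 (tr x1 x2 y1) y2 z1 z2 z3 - l5 y1 (tr x1 x2 y2) z1 z2 z3
       - l5 y1 y2 (tr x1 x2 z1) z2 z3 - l5 y1 y2 z1 (tr x1 x2 z2) z3 - l5 y1 y2 z1 z2 (tr x1 x2 z3)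
       + l5 x1 x2 (tr y1 y2 z1) z2 z3 + l5 x1 x2 z1 (tr y1 y2 z2) z3 + l5 x1 x2 z1 z2 (tr y1 y2 z3)
       - l5 x1 x2 y1 y2 (tr z1 z2 z3) = 0"

text \<open>
  A 2-term $L_\infty$-triple algebra $V_1 \to V_0$. The digits in the names of the binary and
  ternary operations are the degrees of their arguments: for instance \<open>b10\<close> is
  $[\cdot,\cdot] : V_1 \times V_0 \to V_1$, and \<open>t001\<close> is
  $[\cdot,\cdot,\cdot]$ on $V_0 \times V_0 \times V_1$.

  Three groups of axioms are not in the source's list. They do not follow from the others, not
  even when the differential vanishes, and the correspondence with cocycles needs them: that the structure maps are cochains (assumptions \<open>l3_C3\<close> to
  \<open>l5_C5\<close>, in the same spaces as for cocycles), the case of \<open>e2\<close> with the argument of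
  degree 1 in the third place (\<open>e2c\<close>), and the case of \<open>e4\<close> with the argument of
  degree 1 in the third place (\<open>e4d\<close>). For zero differential \<open>e2c\<close> becomes R42 and
  \<open>e4d\<close> becomes R61.
\<close>

locale two_term_Linf_triple_algebra =
  V0: vector_space s0 + V1: vector_space s1
  for s0 :: "'k::field \<Rightarrow> 'a::ab_group_add \<Rightarrow> 'a" and s1 :: "'k \<Rightarrow> 'b::ab_group_add \<Rightarrow> 'b" +
  fixes d :: "'b \<Rightarrow> 'a"
    and b00 :: "'a \<Rightarrow> 'a \<Rightarrow> 'a" and b01 :: "'a \<Rightarrow> 'b \<Rightarrow> 'b" and b10 :: "'b \<Rightarrow> 'a \<Rightarrow> 'b"
    and t000 :: "'a \<Rightarrow> 'a \<Rightarrow> 'a \<Rightarrow> 'a" and t001 :: "'a \<Rightarrow> 'a \<Rightarrow> 'b \<Rightarrow> 'b"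
    and t010 :: "'a \<Rightarrow> 'b \<Rightarrow> 'a \<Rightarrow> 'b" and t100 :: "'b \<Rightarrow> 'a \<Rightarrow> 'a \<Rightarrow> 'b"
    and l3 :: "'a \<Rightarrow> 'a \<Rightarrow> 'a \<Rightarrow> 'b"
    and l4h :: "'a \<Rightarrow> 'a \<Rightarrow> 'a \<Rightarrow> 'a \<Rightarrow> 'b"
    and l4t :: "'a \<Rightarrow> 'a \<Rightarrow> 'a \<Rightarrow> 'a \<Rightarrow> 'b"
    and l5 :: "'a \<Rightarrow> 'a \<Rightarrow> 'a \<Rightarrow> 'a \<Rightarrow> 'a \<Rightarrow> 'b"
  assumes d_lin: "Vector_Spaces.linear s1 s0 d"
    and b00_lin: "bilin s0 s0 s0 b00"
    and b01_lin: "bilin s0 s1 s1 b01"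
    and b10_lin: "bilin s1 s0 s1 b10"
    and t000_lin: "trilin s0 s0 s0 s0 t000"
    and t001_lin: "trilin s0 s0 s1 s1 t001"
    and t010_lin: "trilin s0 s1 s0 s1 t010"
    and t100_lin: "trilin s1 s0 s0 s1 t100"
    and l3_C3: "l3 \<in> C3 s0 s1"
    and l4h_C4: "l4h \<in> C4 s0 s1"
    and l4t_C4: "l4t \<in> C4 s0 s1"
    and l5_C5: "l5 \<in> C5 s0 s1"
    and a1: "b00 x1 x2 = - b00 x2 x1"
    and a2: "b01 x u = - b10 u x"
    and a3: "t000 x1 x2 x3 = - t000 x2 x1 x3"
    and a4: "t001 x1 x2 u = - t001 x2 x1 u"
    and a5: "t100 u x1 x2 = - t010 x1 u x2"
    and b1: "d (b01 x u) = b00 x (d u)"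
    and b2: "b01 (d u) v = b10 u (d v)"
    and c1: "d (t001 x1 x2 u) = t000 x1 x2 (d u)"
    and c2: "d (t100 u x1 x2) = t000 (d u) x1 x2"
    and d1: "t010 (d u) v x = t100 u (d v) x"
    and d2: "t001 x (d u) v = t010 x u (d v)"
    and e1a: "d (l3 x1 x2 x3) =
        b00 (b00 x1 x2) x3 + b00 (b00 x2 x3) x1 + b00 (b00 x3 x1) x2
        + t000 x1 x2 x3 + t000 x2 x3 x1 + t000 x3 x1 x2"
    and e1b: "l3 x1 x2 (d u3) =
        b01 (b00 x1 x2) u3 + b10 (b01 x2 u3) x1 + b10 (b10 u3 x1) x2
        + t001 x1 x2 u3 + t010 x2 u3 x1 + t100 u3 x1 x2"
    and e2a: "d (l4h x1 x2 x3 y1) =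
        t000 (b00 x1 x2) x3 y1 + t000 (b00 x2 x3) x1 y1 + t000 (b00 x3 x1) x2 y1"
    and e2b: "l4h x1 x2 x3 (d u1) =
        t001 (b00 x1 x2) x3 u1 + t001 (b00 x2 x3) x1 u1 + t001 (b00 x3 x1) x2 u1"
    and e2c: "l4h x1 x2 (d u3) y1 =
        t010 (b00 x1 x2) u3 y1 + t100 (b01 x2 u3) x1 y1 + t100 (b10 u3 x1) x2 y1"
    and e3a: "d (l4t x1 x2 y1 y2) =
        b00 (t000 x1 x2 y1) y2 + b00 y1 (t000 x1 x2 y2) - t000 x1 x2 (b00 y1 y2)"
    and e3b: "l4t x1 x2 y1 (d u2) =
        b01 (t000 x1 x2 y1) u2 + b01 y1 (t001 x1 x2 u2) - t001 x1 x2 (b01 y1 u2)"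
    and e3c: "l4t x1 (d u2) y1 y2 =
        b10 (t010 x1 u2 y1) y2 + b01 y1 (t010 x1 u2 y2) - t010 x1 u2 (b00 y1 y2)"
    and e4a: "d (l5 x1 x2 y1 y2 y3) =
        t000 (t000 x1 x2 y1) y2 y3 + t000 y1 (t000 x1 x2 y2) y3 + t000 y1 y2 (t000 x1 x2 y3)
        - t000 x1 x2 (t000 y1 y2 y3)"
    and e4b: "l5 x1 x2 y1 y2 (d u3) =
        t001 (t000 x1 x2 y1) y2 u3 + t001 y1 (t000 x1 x2 y2) u3 + t001 y1 y2 (t001 x1 x2 u3)
        - t001 x1 x2 (t001 y1 y2 u3)"
    and e4c: "l5 x1 (d u2) y1 y2 y3 =
        t100 (t010 x1 u2 y1) y2 y3 + t010 y1 (t010 x1 u2 y2) y3 + t001 y1 y2 (t010 x1 u2 y3)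
        - t010 x1 u2 (t000 y1 y2 y3)"
    and e4d: "l5 x1 x2 (d u1) y2 y3 =
        t100 (t001 x1 x2 u1) y2 y3 + t100 u1 (t000 x1 x2 y2) y3 + t100 u1 y2 (t000 x1 x2 y3)
        - t001 x1 x2 (t100 u1 y2 y3)"
    and f1:
      "t001 x1 x2 (l3 y1 y2 y3) + l4t x1 x2 (b00 y1 y2) y3 + l4t x1 x2 y2 (b00 y1 y3)
       + b10 (l4t x1 x2 y1 y2) y3 + b01 y2 (l4t x1 x2 y1 y3)
       + l5 x1 x2 y1 y2 y3 + l5 x1 x2 y3 y1 y2
       = l4t x1 x2 y1 (b00 y2 y3) + b01 y1 (l4t x1 x2 y2 y3)
       + l3 (t000 x1 x2 y1) y2 y3 + l3 y1 (t000 x1 x2 y2) y3 + l3 y1 y2 (t000 x1 x2 y3)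
       + l5 x1 x2 y3 y2 y1"
    and f2:
      "t001 x1 x2 (l4h y1 y2 y3 z1) + l5 x1 x2 (b00 y1 y2) y3 z1 + l5 x1 x2 y2 (b00 y1 y3) z1
       + t100 (l4t x1 x2 y1 y2) y3 z1 + t010 y2 (l4t x1 x2 y1 y3) z1
       = l5 x1 x2 y1 (b00 y2 y3) z1 + l4h (t000 x1 x2 y1) y2 y3 z1
       + t010 y1 (l4t x1 x2 y2 y3) z1 + l4h y1 y2 y3 (t000 x1 x2 z1)
       + l4h y1 (t000 x1 x2 y2) y3 z1 + l4h y1 y2 (t000 x1 x2 y3) z1"
    and f3:
      "t001 x1 x2 (l4t y1 y2 z1 z2) + l4t x1 x2 (t000 y1 y2 z1) z2 + l4t x1 x2 z1 (t000 y1 y2 z2)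
       + b10 (l5 x1 x2 y1 y2 z1) z2 + b01 z1 (l5 x1 x2 y1 y2 z2)
       = l5 x1 x2 y1 y2 (b00 z1 z2) + t001 y1 y2 (l4t x1 x2 z1 z2)
       + (l4t (t000 x1 x2 y1) y2 z1 z2 + l4t y1 (t000 x1 x2 y2) z1 z2)
       + l4t y1 y2 (t000 x1 x2 z1) z2 + l4t y1 y2 z1 (t000 x1 x2 z2)"
    and f4:
      "t100 (l5 x1 x2 y1 y2 z1) z2 z3 + t010 z1 (l5 x1 x2 y1 y2 z2) z3
       + t001 x1 x2 (l5 y1 y2 z1 z2 z3) + t001 z1 z2 (l5 x1 x2 y1 y2 z3)
       + l5 x1 x2 (t000 y1 y2 z1) z2 z3 + l5 x1 x2 z1 (t000 y1 y2 z2) z3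
       + l5 x1 x2 z1 z2 (t000 y1 y2 z3)
       = t001 y1 y2 (l5 x1 x2 z1 z2 z3)
       + (l5 (t000 x1 x2 y1) y2 z1 z2 z3 + l5 y1 (t000 x1 x2 y2) z1 z2 z3)
       + l5 y1 y2 (t000 x1 x2 z1) z2 z3 + l5 y1 y2 z1 (t000 x1 x2 z2) z3
       + l5 x1 x2 y1 y2 (t000 z1 z2 z3) + l5 y1 y2 z1 z2 (t000 x1 x2 z3)"

record ('k, 'a, 'b) two_term_data =
  scale0 :: "'k \<Rightarrow> 'a \<Rightarrow> 'a"
  scale1 :: "'k \<Rightarrow> 'b \<Rightarrow> 'b"
  diff :: "'b \<Rightarrow> 'a"
  br00 :: "'a \<Rightarrow> 'a \<Rightarrow> 'a"
  br01 :: "'a \<Rightarrow> 'b \<Rightarrow> 'b"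
  br10 :: "'b \<Rightarrow> 'a \<Rightarrow> 'b"
  tr000 :: "'a \<Rightarrow> 'a \<Rightarrow> 'a \<Rightarrow> 'a"
  tr001 :: "'a \<Rightarrow> 'a \<Rightarrow> 'b \<Rightarrow> 'b"
  tr010 :: "'a \<Rightarrow> 'b \<Rightarrow> 'a \<Rightarrow> 'b"
  tr100 :: "'b \<Rightarrow> 'a \<Rightarrow> 'a \<Rightarrow> 'b"
  ell3 :: "'a \<Rightarrow> 'a \<Rightarrow> 'a \<Rightarrow> 'b"
  ell4h :: "'a \<Rightarrow> 'a \<Rightarrow> 'a \<Rightarrow> 'a \<Rightarrow> 'b"
  ell4t :: "'a \<Rightarrow> 'a \<Rightarrow> 'a \<Rightarrow> 'a \<Rightarrow> 'b"
  ell5 :: "'a \<Rightarrow> 'a \<Rightarrow> 'a \<Rightarrow> 'a \<Rightarrow> 'a \<Rightarrow> 'b"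

definition is_two_term_Linf_triple_algebra ::
  "('k::field, 'a::ab_group_add, 'b::ab_group_add) two_term_data \<Rightarrow> bool" where
  "is_two_term_Linf_triple_algebra A \<longleftrightarrow>
     two_term_Linf_triple_algebra (scale0 A) (scale1 A) (diff A)
       (br00 A) (br01 A) (br10 A) (tr000 A) (tr001 A) (tr010 A) (tr100 A)
       (ell3 A) (ell4h A) (ell4t A) (ell5 A)"

definition skeletal :: "('k, 'a::zero, 'b) two_term_data \<Rightarrow> bool" where
  "skeletal A \<longleftrightarrow> diff A = (\<lambda>u. 0)"

record ('k, 'a, 'b) cocycle_data =
  scaleT :: "'k \<Rightarrow> 'a \<Rightarrow> 'a"
  brT :: "'a \<Rightarrow> 'a \<Rightarrow> 'a"
  trT :: "'a \<Rightarrow> 'a \<Rightarrow> 'a \<Rightarrow> 'a"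
  scaleV :: "'k \<Rightarrow> 'b \<Rightarrow> 'b"
  repr_rho :: "'a \<Rightarrow> 'b \<Rightarrow> 'b"
  repr_theta :: "'a \<Rightarrow> 'a \<Rightarrow> 'b \<Rightarrow> 'b"
  repr_D :: "'a \<Rightarrow> 'a \<Rightarrow> 'b \<Rightarrow> 'b"
  coc3 :: "'a \<Rightarrow> 'a \<Rightarrow> 'a \<Rightarrow> 'b"
  coc4h :: "'a \<Rightarrow> 'a \<Rightarrow> 'a \<Rightarrow> 'a \<Rightarrow> 'b"
  coc4t :: "'a \<Rightarrow> 'a \<Rightarrow> 'a \<Rightarrow> 'a \<Rightarrow> 'b"
  coc5 :: "'a \<Rightarrow> 'a \<Rightarrow> 'a \<Rightarrow> 'a \<Rightarrow> 'a \<Rightarrow> 'b"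

text \<open>
  The locale \<open>cocycle_3445\<close> contains the assumptions that $T$ is a Lie triple algebra and
  that $(\rho,\theta,D)$ is a representation.
\<close>

definition is_cocycle_tuple ::
  "('k::field, 'a::ab_group_add, 'b::ab_group_add) cocycle_data \<Rightarrow> bool" where
  "is_cocycle_tuple B \<longleftrightarrow>
     cocycle_3445 (scaleT B) (brT B) (trT B) (scaleV B) (repr_rho B) (repr_theta B) (repr_D B)
       (coc3 B) (coc4h B) (coc4t B) (coc5 B)"

definition cocycle_tuple_of :: "('k, 'a, 'b) two_term_data \<Rightarrow> ('k, 'a, 'b) cocycle_data" where
  "cocycle_tuple_of A =
     \<lparr> scaleT = scale0 A, brT = br00 A, trT = tr000 A,
       scaleV = scale1 A,
       repr_rho = (\<lambda>x1 u. br01 A x1 u),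
       repr_theta = (\<lambda>x1 x2 u. tr100 A u x1 x2),
       repr_D = (\<lambda>x1 x2 u. tr001 A x1 x2 u),
       coc3 = ell3 A, coc4h = ell4h A, coc4t = ell4t A, coc5 = ell5 A \<rparr>"

end

theory Submission
  imports Defs
begin

text \<open>
  With zero differential every structure equation that involves \<open>d\<close> loses its left-hand side, and
  the remaining right-hand sides are, up to the antisymmetries (a), the axioms of a Lie triple
  algebra, of a representation and of a cocycle. Two identities on the \<open>L\<^sub>\<infinity>\<close> side have
  no counterpart among the representation axioms: the antisymmetry of \<open>D\<close>, and \<open>e4b\<close>, which says
  that \<open>D(x\<^sub>1,x\<^sub>2)\<close> acts on the operators \<open>D(y\<^sub>1,y\<^sub>2)\<close> as a derivation. Both follow from R31, which
  expresses \<open>D\<close> through \<open>\<theta>\<close> and \<open>\<rho>\<close>.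
\<close>

section \<open>Multilinear maps and cochains\<close>

lemma linear_0_neg_diff_add:
  assumes "Vector_Spaces.linear s t f"
  shows "f 0 = 0" "f (- x) = - f x" "f (x - y) = f x - f y" "f (x + y) = f x + f y"
proof -
  interpret Vector_Spaces.linear s t f by fact
  show "f 0 = 0" "f (- x) = - f x" "f (x - y) = f x - f y" "f (x + y) = f x + f y"
    by (fact zero neg diff add)+
qed

lemma linear_uminus:
  assumes "Vector_Spaces.linear s t f"
  shows "Vector_Spaces.linear s t (\<lambda>x. - f x)"
proof -
  interpret Vector_Spaces.linear s t f by fact
  show ?thesis
    by unfold_locales (simp_all add: add scale)
qed

lemma bilin_simps:
  assumes "bilin s1 s2 t f"
  shows "f 0 y = 0" "f x 0 = 0" "f (- x) y = - f x y" "f x (- y) = - f x y"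
    "f (x - x') y = f x y - f x' y" "f x (y - y') = f x y - f x y'"
    "f (x + x') y = f x y + f x' y" "f x (y + y') = f x y + f x y'"
proof -
  have l: "Vector_Spaces.linear s1 t (\<lambda>x. f x y)" for y
    using assms by (auto simp: bilin_def)
  have r: "Vector_Spaces.linear s2 t (f x)" for x
    using assms by (auto simp: bilin_def)
  show "f 0 y = 0" "f (- x) y = - f x y"
    "f (x - x') y = f x y - f x' y" "f (x + x') y = f x y + f x' y"
    by (fact linear_0_neg_diff_add[OF l])+
  show "f x 0 = 0" "f x (- y) = - f x y"
    "f x (y - y') = f x y - f x y'" "f x (y + y') = f x y + f x y'"
    by (fact linear_0_neg_diff_add[OF r])+
qed

lemma trilin_simps:
  assumes "trilin s1 s2 s3 t f"
  shows "f 0 y z = 0" "f x 0 z = 0" "f x y 0 = 0"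
    "f (- x) y z = - f x y z" "f x (- y) z = - f x y z" "f x y (- z) = - f x y z"
    "f (x - x') y z = f x y z - f x' y z" "f x (y - y') z = f x y z - f x y' z"
    "f x y (z - z') = f x y z - f x y z'"
    "f (x + x') y z = f x y z + f x' y z" "f x (y + y') z = f x y z + f x y' z"
    "f x y (z + z') = f x y z + f x y z'"
proof -
  have l: "Vector_Spaces.linear s1 t (\<lambda>x. f x y z)" for y z
    using assms by (auto simp: trilin_def)
  have r: "bilin s2 s3 t (f x)" for x
    using assms by (auto simp: trilin_def)
  show "f 0 y z = 0" "f (- x) y z = - f x y z"
    "f (x - x') y z = f x y z - f x' y z" "f (x + x') y z = f x y z + f x' y z"
    by (fact linear_0_neg_diff_add[OF l])+
  show "f x 0 z = 0" "f x y 0 = 0" "f x (- y) z = - f x y z" "f x y (- z) = - f x y z"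
    "f x (y - y') z = f x y z - f x y' z" "f x y (z - z') = f x y z - f x y z'"
    "f x (y + y') z = f x y z + f x y' z" "f x y (z + z') = f x y z + f x y z'"
    by (fact bilin_simps[OF r])+
qed

text \<open>Meant for the bracket of degrees (1,0), which is recovered from \<open>\<rho>\<close> as
  [u,x] = -\<open>\<rho> x u\<close>.\<close>

lemma bilin_uminus_swap:
  assumes "bilin s1 s2 t f"
  shows "bilin s2 s1 t (\<lambda>y x. - f x y)"
  using assms by (auto simp: bilin_def intro!: linear_uminus)

text \<open>\<open>\<theta>\<close> takes the vector as its last argument, \<open>t100\<close> as
  its first. This lemma and the next translate between the two orders.\<close>

lemma trilin_rotate:
  assumes "trilin s1 s2 s3 t f"
  shows "trilin s3 s1 s2 t (\<lambda>z x y. f x y z)"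
  using assms by (auto simp: trilin_def bilin_def)

lemma trilin_rotate':
  assumes "trilin s1 s2 s3 t f"
  shows "trilin s2 s3 s1 t (\<lambda>y z x. f x y z)"
  using assms by (auto simp: trilin_def bilin_def)

lemma trilin_uminus_swap23:
  assumes "trilin s1 s2 s3 t f"
  shows "trilin s1 s3 s2 t (\<lambda>x z y. - f x y z)"
  using assms by (auto simp: trilin_def bilin_def intro!: linear_uminus)

text \<open>The slots listed here, and in the analogue for five arguments, are those that receive
  \<open>d u\<close> in \<open>e2b\<close> to \<open>e4d\<close>. They hold 0 in the skeletal
  case.\<close>

lemma quadrilin_0:
  assumes "quadrilin s t f"
  shows "f x 0 z w = 0" "f x y 0 w = 0" "f x y z 0 = 0"
  using assms by (auto simp: quadrilin_def dest: trilin_simps)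

lemma quinquelin_0:
  assumes "quinquelin s t f"
  shows "f x 0 z v w = 0" "f x y 0 v w = 0" "f x y z v 0 = 0"
proof -
  have q: "quadrilin s t (f x)"
    using assms by (auto simp: quinquelin_def)
  have l: "Vector_Spaces.linear s t (\<lambda>y. f x y z v w)"
    using q by (auto simp: quadrilin_def)
  show "f x 0 z v w = 0"
    by (fact linear_0_neg_diff_add(1)[OF l])
  show "f x y 0 v w = 0" "f x y z v 0 = 0"
    by (fact quadrilin_0[OF q])+
qed

text \<open>Polarization: expand the value at \<open>z + w\<close> in both slots. The rule
  reconciles \<open>f1\<close> with \<open>cocycle1\<close>, which order the arguments of one
  \<open>l5\<close>-term differently.\<close>

lemma C5_antisym34:
  assumes "f \<in> C5 s t"
  shows "f x y z w v = - f x y w z v"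
proof -
  have tl: "trilin s s s t (f x y)"
    using assms by (auto simp: C5_def quinquelin_def quadrilin_def)
  have "f x y (z + w) (z + w) v = 0"
    using assms by (auto simp: C5_def)
  moreover have "f x y z z v = 0" "f x y w w v = 0"
    using assms by (auto simp: C5_def)
  ultimately show ?thesis
    by (simp add: trilin_simps[OF tl] eq_neg_iff_add_eq_0 add.commute)
qed

section \<open>Consequences of the representation axioms\<close>

context lie_triple_representation
begin

lemmas rho_simps = bilin_simps[OF rho_lin]
lemmas theta_simps = trilin_simps[OF theta_lin]
lemmas br_simps = bilin_simps[OF br_bilin]
lemmas tr_simps = trilin_simps[OF tr_trilin]

lemma br_antisym: "br x y = - br y x"
  using LY1[of x y] by (simp add: eq_neg_iff_add_eq_0)

lemma tr_antisym: "tr x y z = - tr y x z"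
  using LY2[of x y z] by (simp add: eq_neg_iff_add_eq_0)

text \<open>R31 solved for \<open>D\<close>, so that identities about \<open>D\<close> reduce to
  identities about \<open>\<theta>\<close>, \<open>\<rho>\<close> and the bracket.\<close>

lemma D_eq: "D x y u = \<theta> y x u - \<theta> x y u - \<rho> (br x y) u + \<rho> x (\<rho> y u) - \<rho> y (\<rho> x u)"
  using R31[of x y u] by (simp add: algebra_simps eq_neg_iff_add_eq_0)

lemma D_antisym: "D x y u = - D y x u"
  unfolding D_eq using br_antisym[of x y] by (simp add: rho_simps)

lemma D_rho: "D x1 x2 (\<rho> y u) = \<rho> y (D x1 x2 u) + \<rho> (tr x1 x2 y) u"
  using R51[of x1 x2 y u] by (simp add: algebra_simps)

lemma D_theta:
  "D x1 x2 (\<theta> y1 y2 u) = \<theta> y1 y2 (D x1 x2 u) + \<theta> (tr x1 x2 y1) y2 u + \<theta> y1 (tr x1 x2 y2) u"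
  using R61[of x1 x2 y1 y2 u] by (simp add: algebra_simps)

text \<open>By R51, R61 and LY5 the action of \<open>D x1 x2\<close> is a derivation with respect to
  \<open>\<rho>\<close>, \<open>\<theta>\<close> and the bracket of T, hence with respect to every
  expression built from them. By R31, \<open>D y1 y2\<close> is such an expression.\<close>

lemma D_commutator:
  "D x1 x2 (D y1 y2 u) = D y1 y2 (D x1 x2 u) + D (tr x1 x2 y1) y2 u + D y1 (tr x1 x2 y2) u"
  \<comment> \<open>The operators \<open>D x1 x2\<close> stay folded, so that \<open>D_rho\<close>
    and \<open>D_theta\<close> can move them inwards.\<close>
  unfolding D_eq[of y1 y2] D_eq[of "tr x1 x2 y1"] D_eq[of y1 "tr x1 x2 y2"]
  by (simp add: trilin_simps[OF D_lin] D_rho D_theta LY5 rho_simps algebra_simps)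

end

section \<open>From skeletal algebras to cocycles\<close>

lemma cocycle_3445_if_skeletal:
  assumes "two_term_Linf_triple_algebra s0 s1 (\<lambda>u. 0) b00 b01 b10 t000 t001 t010 t100 l3 l4h l4t l5"
  shows "cocycle_3445 s0 b00 t000 s1 b01 (\<lambda>x y u. t100 u x y) t001 l3 l4h l4t l5"
proof -
  interpret A: two_term_Linf_triple_algebra
    s0 s1 "\<lambda>u. 0" b00 b01 b10 t000 t001 t010 t100 l3 l4h l4t l5
    by fact
  \<comment> \<open>Orienting a2 and a5 this way eliminates \<open>b10\<close> and
    \<open>t010\<close> in favour of \<open>b01\<close> and \<open>t100\<close>, which play the
    roles of \<open>\<rho>\<close> and \<open>\<theta>\<close>.\<close>
  have b10: "b10 u x = - b01 x u" for u x
    by (simp add: A.a2)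
  have t010: "t010 x u y = - t100 u x y" for x u y
    by (simp add: A.a5)
  have l3: "trilin s0 s0 s0 s1 l3" and l4h: "quadrilin s0 s1 l4h" and l4t: "quadrilin s0 s1 l4t"
    and l5: "quinquelin s0 s1 l5"
    using A.l3_C3 A.l4h_C4 A.l4t_C4 A.l5_C5 by (auto simp: C3_def C4_def C5_def)
  note zero = trilin_simps(1-3)[OF l3] quadrilin_0[OF l4h] quadrilin_0[OF l4t] quinquelin_0[OF l5]
  note b01_simps = bilin_simps[OF A.b01_lin]
  note t100_simps = trilin_simps[OF A.t100_lin]
  note t001_simps = trilin_simps[OF A.t001_lin]
  note simps = zero b10 t010 b01_simps t100_simps t001_simps
  show ?thesis
  proof unfold_locales
    show "bilin s0 s0 s0 b00" "trilin s0 s0 s0 s0 t000" "bilin s0 s1 s1 b01"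
      "trilin s0 s0 s1 s1 t001" "l3 \<in> C3 s0 s1" "l4h \<in> C4 s0 s1" "l4t \<in> C4 s0 s1" "l5 \<in> C5 s0 s1"
      by (fact A.b00_lin A.t000_lin A.b01_lin A.t001_lin A.l3_C3 A.l4h_C4 A.l4t_C4 A.l5_C5)+
    show "trilin s0 s0 s1 s1 (\<lambda>x y u. t100 u x y)"
      by (rule trilin_rotate'[OF A.t100_lin])
  next
    \<comment> \<open>The axioms LY1 to LY6 come from the identities with all arguments in degree 0,
      where \<open>d\<close> kills the left-hand side.\<close>
    fix x1 x2 show "b00 x1 x2 + b00 x2 x1 = 0"
      using A.a1[of x1 x2] by simp
  next
    fix x1 x2 x3 show "t000 x1 x2 x3 + t000 x2 x1 x3 = 0"
      using A.a3[of x1 x2 x3] by simp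
  next
    fix x1 x2 x3 show "b00 (b00 x1 x2) x3 + b00 (b00 x2 x3) x1 + b00 (b00 x3 x1) x2
      + t000 x1 x2 x3 + t000 x2 x3 x1 + t000 x3 x1 x2 = 0"
      using A.e1a[of x1 x2 x3] by simp
  next
    fix x1 x2 x3 y1
    show "t000 (b00 x1 x2) x3 y1 + t000 (b00 x2 x3) x1 y1 + t000 (b00 x3 x1) x2 y1 = 0"
      using A.e2a[of x1 x2 x3 y1] by simp
  next
    fix x1 x2 y1 y2
    show "t000 x1 x2 (b00 y1 y2) = b00 (t000 x1 x2 y1) y2 + b00 y1 (t000 x1 x2 y2)"
      using A.e3a[of x1 x2 y1 y2] by simp
  next
    fix x1 x2 y1 y2 y3
    show "t000 x1 x2 (t000 y1 y2 y3) = t000 (t000 x1 x2 y1) y2 y3 + t000 y1 (t000 x1 x2 y2) y3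
      + t000 y1 y2 (t000 x1 x2 y3)"
      using A.e4a[of x1 x2 y1 y2 y3] by simp
  next
    \<comment> \<open>The representation axioms come from the identities with one argument of degree
      1, in the order R31, R41, R42, R51, R52, R61, R62.\<close>
    fix x1 x2 u
    show "t001 x1 x2 u - t100 u x2 x1 + t100 u x1 x2 + b01 (b00 x1 x2) u
      - (b01 x1 (b01 x2 u) - b01 x2 (b01 x1 u)) = 0"
      \<comment> \<open>The two nested brackets starting with \<open>b10\<close> become, after a2,
        the commutator of the operators \<open>b01 x1\<close> and \<open>b01 x2\<close>.\<close>
      using A.e1b[of x1 x2 u] by (simp add: simps algebra_simps)
  next
    fix x1 x2 x3 u
    show "t001 (b00 x1 x2) x3 u + t001 (b00 x2 x3) x1 u + t001 (b00 x3 x1) x2 u = 0"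
      using A.e2b[of x1 x2 x3 u] by (simp add: simps)
  next
    fix x1 x2 x3 u
    show "t100 u (b00 x1 x2) x3 = t100 (b01 x2 u) x1 x3 - t100 (b01 x1 u) x2 x3"
      using A.e2c[of x1 x2 x3 u] by (simp add: simps algebra_simps)
  next
    fix x1 x2 y2 u
    show "t001 x1 x2 (b01 y2 u) - b01 y2 (t001 x1 x2 u) = b01 (t000 x1 x2 y2) u"
      using A.e3b[of x1 x2 y2 u] by (simp add: simps algebra_simps)
  next
    fix x1 y1 y2 u
    show "t100 u x1 (b00 y1 y2) = b01 y1 (t100 u x1 y2) - b01 y2 (t100 u x1 y1)"
      using A.e3c[of x1 y1 y2 u] by (simp add: simps algebra_simps)
  next
    fix x1 x2 y1 y2 u
    show "t001 x1 x2 (t100 u y1 y2) - t100 (t001 x1 x2 u) y1 y2 =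
      t100 u (t000 x1 x2 y1) y2 + t100 u y1 (t000 x1 x2 y2)"
      using A.e4d[of x1 x2 y1 y2 u] by (simp add: simps algebra_simps)
  next
    fix x1 y1 y2 y3 u
    show "t100 u x1 (t000 y1 y2 y3) = t100 (t100 u x1 y1) y2 y3 - t100 (t100 u x1 y2) y1 y3
      + t001 y1 y2 (t100 u x1 y3)"
      using A.e4c[of x1 y1 y2 y3 u] by (simp add: simps algebra_simps)
  next
    fix x1 x2 y1 y2 y3
    show "t001 x1 x2 (l3 y1 y2 y3)
       - l3 (t000 x1 x2 y1) y2 y3 - l3 y1 (t000 x1 x2 y2) y3 - l3 y1 y2 (t000 x1 x2 y3)
       + l4t x1 x2 (b00 y1 y2) y3 + l4t x1 x2 y2 (b00 y1 y3) - l4t x1 x2 y1 (b00 y2 y3)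
       - b01 y1 (l4t x1 x2 y2 y3) + b01 y2 (l4t x1 x2 y1 y3) - b01 y3 (l4t x1 x2 y1 y2)
       + l5 x1 x2 y1 y2 y3 + l5 x1 x2 y2 y3 y1 + l5 x1 x2 y3 y1 y2 = 0"
      \<comment> \<open>Antisymmetry turns the term \<open>l5 x1 x2 y3 y2 y1\<close> on the right of
        \<open>f1\<close> into \<open>l5 x1 x2 y2 y3 y1\<close> on the left, which completes the
        cyclic sum.\<close>
      using A.f1[of x1 x2 y1 y2 y3] C5_antisym34[OF A.l5_C5, of x1 x2 y3 y2 y1]
      by (simp add: b10 algebra_simps)
  next
    fix x1 x2 y1 y2 y3 z1
    show "t001 x1 x2 (l4h y1 y2 y3 z1)
       - l4h (t000 x1 x2 y1) y2 y3 z1 - l4h y1 (t000 x1 x2 y2) y3 z1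
       - l4h y1 y2 (t000 x1 x2 y3) z1 - l4h y1 y2 y3 (t000 x1 x2 z1)
       + t100 (l4t x1 x2 y2 y3) y1 z1 + t100 (l4t x1 x2 y1 y2) y3 z1 - t100 (l4t x1 x2 y1 y3) y2 z1
       + l5 x1 x2 (b00 y1 y2) y3 z1 + l5 x1 x2 y2 (b00 y1 y3) z1 - l5 x1 x2 y1 (b00 y2 y3) z1 = 0"
      using A.f2[of x1 x2 y1 y2 y3 z1] by (simp add: t010 algebra_simps)
  next
    fix x1 x2 y1 y2 z1 z2
    show "t001 x1 x2 (l4t y1 y2 z1 z2) - t001 y1 y2 (l4t x1 x2 z1 z2)
       + b01 z1 (l5 x1 x2 y1 y2 z2) - b01 z2 (l5 x1 x2 y1 y2 z1) - l5 x1 x2 y1 y2 (b00 z1 z2)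
       - l4t (t000 x1 x2 y1) y2 z1 z2 - l4t y1 (t000 x1 x2 y2) z1 z2
       - l4t y1 y2 (t000 x1 x2 z1) z2 - l4t y1 y2 z1 (t000 x1 x2 z2)
       + l4t x1 x2 (t000 y1 y2 z1) z2 + l4t x1 x2 z1 (t000 y1 y2 z2) = 0"
      using A.f3[of x1 x2 y1 y2 z1 z2] by (simp add: b10 algebra_simps)
  next
    fix x1 x2 y1 y2 z1 z2 z3
    show "t100 (l5 x1 x2 y1 y2 z1) z2 z3 - t100 (l5 x1 x2 y1 y2 z2) z1 z3
       + t001 x1 x2 (l5 y1 y2 z1 z2 z3) - t001 y1 y2 (l5 x1 x2 z1 z2 z3) + t001 z1 z2 (l5 x1 x2 y1 y2 z3)
       - l5 (t000 x1 x2 y1) y2 z1 z2 z3 - l5 y1 (t000 x1 x2 y2) z1 z2 z3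
       - l5 y1 y2 (t000 x1 x2 z1) z2 z3 - l5 y1 y2 z1 (t000 x1 x2 z2) z3 - l5 y1 y2 z1 z2 (t000 x1 x2 z3)
       + l5 x1 x2 (t000 y1 y2 z1) z2 z3 + l5 x1 x2 z1 (t000 y1 y2 z2) z3 + l5 x1 x2 z1 z2 (t000 y1 y2 z3)
       - l5 x1 x2 y1 y2 (t000 z1 z2 z3) = 0"
      using A.f4[of x1 x2 y1 y2 z1 z2 z3] by (simp add: t010 algebra_simps)
  qed
qed

section \<open>From cocycles to skeletal algebras\<close>

text \<open>The operations of degrees (1,0) and (0,1,0) are given the values that a2 and a5
  force.\<close>

lemma skeletal_if_cocycle_3445:
  assumes "cocycle_3445 sT br tr sV \<rho> \<theta> D l3 l4h l4t l5"
  shows "two_term_Linf_triple_algebra sT sV (\<lambda>u. 0) br \<rho> (\<lambda>u x. - \<rho> x u)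
    tr D (\<lambda>x u y. - \<theta> x y u) (\<lambda>u x y. \<theta> x y u) l3 l4h l4t l5"
proof -
  interpret B: cocycle_3445 sT br tr sV \<rho> \<theta> D l3 l4h l4t l5
    by fact
  have l3: "trilin sT sT sT sV l3" and l4h: "quadrilin sT sV l4h" and l4t: "quadrilin sT sV l4t"
    and l5: "quinquelin sT sV l5"
    using B.l3_C3 B.l4h_C4 B.l4t_C4 B.l5_C5 by (auto simp: C3_def C4_def C5_def)
  note zero = trilin_simps(1-3)[OF l3] quadrilin_0[OF l4h] quadrilin_0[OF l4t] quinquelin_0[OF l5]
  note simps = zero B.rho_simps B.theta_simps B.br_simps B.tr_simps trilin_simps[OF B.D_lin]
  show ?thesis
  proof unfold_locales
    show "bilin sT sT sT br" "trilin sT sT sT sT tr" "bilin sT sV sV \<rho>"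
      "trilin sT sT sV sV D" "l3 \<in> C3 sT sV" "l4h \<in> C4 sT sV" "l4t \<in> C4 sT sV" "l5 \<in> C5 sT sV"
      by (fact B.br_bilin B.tr_trilin B.rho_lin B.D_lin B.l3_C3 B.l4h_C4 B.l4t_C4 B.l5_C5)+
    show "bilin sV sT sV (\<lambda>u x. - \<rho> x u)"
      by (rule bilin_uminus_swap[OF B.rho_lin])
    show "trilin sV sT sT sV (\<lambda>u x y. \<theta> x y u)"
      by (rule trilin_rotate[OF B.theta_lin])
    show "trilin sT sV sT sV (\<lambda>x u y. - \<theta> x y u)"
      by (rule trilin_uminus_swap23[OF B.theta_lin])
  next
    fix x1 x2 show "br x1 x2 = - br x2 x1"
      by (rule B.br_antisym)
  next
    fix x1 x2 x3 show "tr x1 x2 x3 = - tr x2 x1 x3"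
      by (rule B.tr_antisym)
  next
    fix x1 x2 u show "D x1 x2 u = - D x2 x1 u"
      by (rule B.D_antisym)
  next
    fix x1 x2 x3 show "0 = br (br x1 x2) x3 + br (br x2 x3) x1 + br (br x3 x1) x2
      + tr x1 x2 x3 + tr x2 x3 x1 + tr x3 x1 x2"
      by (simp add: B.LY3)
  next
    \<comment> \<open>Each equation with \<open>d u\<close> among the arguments of a structure map
      now has left-hand side 0 by multilinearity.\<close>
    fix x1 x2 u show "l3 x1 x2 0 = \<rho> (br x1 x2) u + - \<rho> x1 (\<rho> x2 u) + - \<rho> x2 (- \<rho> x1 u)
      + D x1 x2 u + - \<theta> x2 x1 u + \<theta> x1 x2 u"
      using B.R31[of x1 x2 u] by (simp add: simps algebra_simps)
  next
    fix x1 x2 x3 y1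
    show "0 = tr (br x1 x2) x3 y1 + tr (br x2 x3) x1 y1 + tr (br x3 x1) x2 y1"
      by (simp add: B.LY4)
  next
    fix x1 x2 x3 u
    show "l4h x1 x2 x3 0 = D (br x1 x2) x3 u + D (br x2 x3) x1 u + D (br x3 x1) x2 u"
      by (simp add: B.R41 simps)
  next
    fix x1 x2 u y1
    show "l4h x1 x2 0 y1 = - \<theta> (br x1 x2) y1 u + \<theta> x1 y1 (\<rho> x2 u) + \<theta> x2 y1 (- \<rho> x1 u)"
      by (simp add: B.R42 simps)
  next
    fix x1 x2 y1 y2
    show "0 = br (tr x1 x2 y1) y2 + br y1 (tr x1 x2 y2) - tr x1 x2 (br y1 y2)"
      by (simp add: B.LY5)
  next
    fix x1 x2 y1 u
    show "l4t x1 x2 y1 0 = \<rho> (tr x1 x2 y1) u + \<rho> y1 (D x1 x2 u) - D x1 x2 (\<rho> y1 u)"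
      by (simp add: B.D_rho[of x1 x2 y1 u] zero)
  next
    fix x1 u y1 y2
    show "l4t x1 0 y1 y2 = - \<rho> y2 (- \<theta> x1 y1 u) + \<rho> y1 (- \<theta> x1 y2 u) - - \<theta> x1 (br y1 y2) u"
      by (simp add: B.R52 simps)
  next
    fix x1 x2 y1 y2 y3
    show "0 = tr (tr x1 x2 y1) y2 y3 + tr y1 (tr x1 x2 y2) y3 + tr y1 y2 (tr x1 x2 y3)
      - tr x1 x2 (tr y1 y2 y3)"
      using B.LY6[of x1 x2 y1 y2 y3] by simp
  next
    fix x1 x2 y1 y2 u
    show "l5 x1 x2 y1 y2 0 = D (tr x1 x2 y1) y2 u + D y1 (tr x1 x2 y2) u + D y1 y2 (D x1 x2 u)
      - D x1 x2 (D y1 y2 u)"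
      by (simp add: B.D_commutator[of x1 x2 y1 y2 u] zero)
  next
    fix x1 u y1 y2 y3
    show "l5 x1 0 y1 y2 y3 = \<theta> y2 y3 (- \<theta> x1 y1 u) + - \<theta> y1 y3 (- \<theta> x1 y2 u)
      + D y1 y2 (- \<theta> x1 y3 u) - - \<theta> x1 (tr y1 y2 y3) u"
      by (simp add: B.R62[of x1 y1 y2 y3 u] simps)
  next
    fix x1 x2 u y2 y3
    show "l5 x1 x2 0 y2 y3 = \<theta> y2 y3 (D x1 x2 u) + \<theta> (tr x1 x2 y2) y3 u + \<theta> y2 (tr x1 x2 y3) u
      - D x1 x2 (\<theta> y2 y3 u)"
      by (simp add: B.D_theta[of x1 x2 y2 y3 u] zero)
  next
    fix x1 x2 y1 y2 y3
    show "D x1 x2 (l3 y1 y2 y3) + l4t x1 x2 (br y1 y2) y3 + l4t x1 x2 y2 (br y1 y3)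
       + - \<rho> y3 (l4t x1 x2 y1 y2) + \<rho> y2 (l4t x1 x2 y1 y3)
       + l5 x1 x2 y1 y2 y3 + l5 x1 x2 y3 y1 y2
       = l4t x1 x2 y1 (br y2 y3) + \<rho> y1 (l4t x1 x2 y2 y3)
       + l3 (tr x1 x2 y1) y2 y3 + l3 y1 (tr x1 x2 y2) y3 + l3 y1 y2 (tr x1 x2 y3)
       + l5 x1 x2 y3 y2 y1"
      using B.cocycle1[of x1 x2 y1 y2 y3] C5_antisym34[OF B.l5_C5, of x1 x2 y3 y2 y1]
      by (simp add: algebra_simps)
  next
    fix x1 x2 y1 y2 y3 z1
    show "D x1 x2 (l4h y1 y2 y3 z1) + l5 x1 x2 (br y1 y2) y3 z1 + l5 x1 x2 y2 (br y1 y3) z1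
       + \<theta> y3 z1 (l4t x1 x2 y1 y2) + - \<theta> y2 z1 (l4t x1 x2 y1 y3)
       = l5 x1 x2 y1 (br y2 y3) z1 + l4h (tr x1 x2 y1) y2 y3 z1
       + - \<theta> y1 z1 (l4t x1 x2 y2 y3) + l4h y1 y2 y3 (tr x1 x2 z1)
       + l4h y1 (tr x1 x2 y2) y3 z1 + l4h y1 y2 (tr x1 x2 y3) z1"
      using B.cocycle2[of x1 x2 y1 y2 y3 z1] by (simp add: algebra_simps)
  next
    fix x1 x2 y1 y2 z1 z2
    show "D x1 x2 (l4t y1 y2 z1 z2) + l4t x1 x2 (tr y1 y2 z1) z2 + l4t x1 x2 z1 (tr y1 y2 z2)
       + - \<rho> z2 (l5 x1 x2 y1 y2 z1) + \<rho> z1 (l5 x1 x2 y1 y2 z2)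
       = l5 x1 x2 y1 y2 (br z1 z2) + D y1 y2 (l4t x1 x2 z1 z2)
       + (l4t (tr x1 x2 y1) y2 z1 z2 + l4t y1 (tr x1 x2 y2) z1 z2)
       + l4t y1 y2 (tr x1 x2 z1) z2 + l4t y1 y2 z1 (tr x1 x2 z2)"
      using B.cocycle3[of x1 x2 y1 y2 z1 z2] by (simp add: algebra_simps)
  next
    fix x1 x2 y1 y2 z1 z2 z3
    show "\<theta> z2 z3 (l5 x1 x2 y1 y2 z1) + - \<theta> z1 z3 (l5 x1 x2 y1 y2 z2)
       + D x1 x2 (l5 y1 y2 z1 z2 z3) + D z1 z2 (l5 x1 x2 y1 y2 z3)
       + l5 x1 x2 (tr y1 y2 z1) z2 z3 + l5 x1 x2 z1 (tr y1 y2 z2) z3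
       + l5 x1 x2 z1 z2 (tr y1 y2 z3)
       = D y1 y2 (l5 x1 x2 z1 z2 z3)
       + (l5 (tr x1 x2 y1) y2 z1 z2 z3 + l5 y1 (tr x1 x2 y2) z1 z2 z3)
       + l5 y1 y2 (tr x1 x2 z1) z2 z3 + l5 y1 y2 z1 (tr x1 x2 z2) z3
       + l5 x1 x2 y1 y2 (tr z1 z2 z3) + l5 y1 y2 z1 z2 (tr x1 x2 z3)"
      \<comment> \<open>The instantiation follows the order of first occurrence in
        \<open>cocycle4\<close>, which starts with \<open>\<theta> z2 z3\<close>.\<close>
      using B.cocycle4[of z2 z3 x1 x2 y1 y2 z1] by (simp add: algebra_simps)
  \<comment> \<open>Here a2 and a5 hold by double negation, and in the axioms b to d both sides
    vanish because some argument is 0.\<close>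
  qed (simp_all add: simps)
qed

section \<open>The inverse map and the bijection\<close>

definition skeletal_of :: "('k, 'a::zero, 'b::uminus) cocycle_data \<Rightarrow> ('k, 'a, 'b) two_term_data" where
  "skeletal_of B =
     \<lparr> scale0 = scaleT B, scale1 = scaleV B, diff = (\<lambda>u. 0),
       br00 = brT B, br01 = repr_rho B, br10 = (\<lambda>u x. - repr_rho B x u),
       tr000 = trT B, tr001 = repr_D B, tr010 = (\<lambda>x u y. - repr_theta B x y u),
       tr100 = (\<lambda>u x y. repr_theta B x y u),
       ell3 = coc3 B, ell4h = coc4h B, ell4t = coc4t B, ell5 = coc5 B \<rparr>"

text \<open>Passing to the cocycle tuple forgets only \<open>diff\<close>, \<open>br10\<close> and
  \<open>tr010\<close>; the first is zero by skeletality, the others are determined by a2 and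
  a5.\<close>

lemma skeletal_of_cocycle_tuple_of:
  assumes "is_two_term_Linf_triple_algebra A" and "skeletal A"
  shows "skeletal_of (cocycle_tuple_of A) = A"
proof -
  interpret two_term_Linf_triple_algebra "scale0 A" "scale1 A" "diff A" "br00 A" "br01 A" "br10 A"
    "tr000 A" "tr001 A" "tr010 A" "tr100 A" "ell3 A" "ell4h A" "ell4t A" "ell5 A"
    using assms(1) by (simp add: is_two_term_Linf_triple_algebra_def)
  show ?thesis
    using assms(2)
    by (intro two_term_data.equality)
      (simp_all add: skeletal_of_def cocycle_tuple_of_def skeletal_def fun_eq_iff a2 a5)
qed

theorem theorem5p1:
  assumes "CHAR('k::alg_closed_field) \<noteq> 2" and "CHAR('k) \<noteq> 3"
  shows "bij_betw cocycle_tuple_of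
    {A :: ('k, 'a::ab_group_add, 'b::ab_group_add) two_term_data.
       is_two_term_Linf_triple_algebra A \<and> skeletal A}
    {B :: ('k, 'a, 'b) cocycle_data. is_cocycle_tuple B}"
proof (rule bij_betwI[where g = skeletal_of])
  show "cocycle_tuple_of \<in>
    {A :: ('k, 'a, 'b) two_term_data. is_two_term_Linf_triple_algebra A \<and> skeletal A} \<rightarrow>
    {B. is_cocycle_tuple B}"
    using cocycle_3445_if_skeletal
    by (force simp: is_two_term_Linf_triple_algebra_def skeletal_def is_cocycle_tuple_def
        cocycle_tuple_of_def)
  show "skeletal_of \<in> {B :: ('k, 'a, 'b) cocycle_data. is_cocycle_tuple B} \<rightarrow>
    {A. is_two_term_Linf_triple_algebra A \<and> skeletal A}"
    using skeletal_if_cocycle_3445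
    by (auto simp: is_two_term_Linf_triple_algebra_def skeletal_def is_cocycle_tuple_def
        skeletal_of_def)
\<comment> \<open>The other composite is the identity by unfolding: \<open>cocycle_tuple_of\<close>
  reads back exactly the components that \<open>skeletal_of\<close> stored.\<close>
qed (auto simp: skeletal_of_cocycle_tuple_of, simp add: skeletal_of_def cocycle_tuple_of_def)

end
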